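(* Let $G=(V,E)$ be a connected graph on $n$ nodes and let $r\ge1$ be an integer with $r\le\delta(G)$. (i) If $r\ge 2$, then $r\le \overleftarrow{MD}_r(G)\le n$. (ii) If $r=1$, then $\overleftarrow{MD}_r(G)=2$ if $G$ is bipartite and $\overleftarrow{MD}_r(G)=1$ otherwise.
   Context: $\delta(G)$ is the minimum degree of $G$; in (ii) $G$ has at least two nodes. A configuration is a map $\mathcal{C}:V\to\{b,w\}$ (black/white). In two-way $r$-bootstrap percolation, starting from $\mathcal{C}_0$, in each round $t\ge1$ all nodes update simultaneously: $\mathcal{C}_t(v)=b$ if $v$ has at least $r$ neighbors that are black in $\mathcal{C}_{t-1}$, and $\mathcal{C}_t(v)=w$ otherwise. A set $D\subseteq V$ is a dynamo if for every initial configuration in which all nodes of $D$ are black, there is a round at which all nodes of $V$ are black. $\overleftarrow{MD}_r(G)$ denotes the minimum size of a dynamo in two-way $r$-bootstrap percolation on $G$. Standing assumptions: $r\le\delta(G)$, and $r$ is fixed while $n\to\infty$. *)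

theory Defs
  imports "Graph_Theory.Digraph_Component"
begin

text \<open>
  Finite simple undirected graphs are loop-free symmetric digraphs without parallel arcs
  (locale \<^locale>\<open>graph\<close>): an edge is a pair of opposite arcs, so the degree of a
  node is its out-degree.
\<close>

definition neighbours :: "('a, 'b) pre_digraph \<Rightarrow> 'a \<Rightarrow> 'a set" where
  "neighbours G v = {u. v \<rightarrow>\<^bsub>G\<^esub> u}"

definition min_degree :: "('a, 'b) pre_digraph \<Rightarrow> nat" where
  "min_degree G = Min (out_degree G ` verts G)"

definition bipartite :: "('a, 'b) pre_digraph \<Rightarrow> bool" where
  "bipartite G \<longleftrightarrow>
    (\<exists>A B. A \<union> B = verts G \<and> A \<inter> B = {} \<and>
      (\<forall>u v. u \<rightarrow>\<^bsub>G\<^esub> v \<longrightarrow> (u \<in> A \<and> v \<in> B) \<or> (u \<in> B \<and> v \<in> A)))"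

datatype colour = Black | White

definition two_way_step ::
  "('a, 'b) pre_digraph \<Rightarrow> nat \<Rightarrow> ('a \<Rightarrow> colour) \<Rightarrow> 'a \<Rightarrow> colour" where
  "two_way_step G r C v =
    (if r \<le> card {u \<in> neighbours G v. C u = Black} then Black else White)"

primrec two_way_config ::
  "('a, 'b) pre_digraph \<Rightarrow> nat \<Rightarrow> ('a \<Rightarrow> colour) \<Rightarrow> nat \<Rightarrow> 'a \<Rightarrow> colour" where
  "two_way_config G r C\<^sub>0 0 = C\<^sub>0"
| "two_way_config G r C\<^sub>0 (Suc t) = two_way_step G r (two_way_config G r C\<^sub>0 t)"

text \<open>
  Colours outside \<^term>\<open>verts G\<close> are irrelevant: in a well-formed digraph the
  neighbours of a node are nodes of the graph.
\<close>

definition two_way_dynamo :: "('a, 'b) pre_digraph \<Rightarrow> nat \<Rightarrow> 'a set \<Rightarrow> bool" where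
  "two_way_dynamo G r D \<longleftrightarrow>
    D \<subseteq> verts G \<and>
    (\<forall>C\<^sub>0. (\<forall>v\<in>D. C\<^sub>0 v = Black) \<longrightarrow>
      (\<exists>t. \<forall>v\<in>verts G. two_way_config G r C\<^sub>0 t v = Black))"

definition two_way_MD :: "('a, 'b) pre_digraph \<Rightarrow> nat \<Rightarrow> nat" where
  "two_way_MD G r = Min (card ` {D. two_way_dynamo G r D})"

end

theory Submission
  imports Defs
begin

text \<open>
  With fewer than \<open>r\<close> black nodes everything is white after one round and stays white, while
  the all-black configuration is fixed because every degree is at least \<open>r\<close>; hence a dynamo has
  at least \<open>r\<close> nodes. For \<open>r = 1\<close> a node is black in round \<open>t\<close> iff some walk of length exactly
  \<open>t\<close> joins it to an initially black node, so everything is a question of walk parities. In a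
  bipartite graph the walks from two adjacent nodes to a given node never have equal length, so
  one node is not enough, whereas the two ends of an edge supply both parities. In a non-bipartite
  connected graph every node lies on an odd closed walk, which supplies both parities by itself.
\<close>

section \<open>Walks as powers of a relation\<close>

lemma relpow_sym:
  assumes "sym R" and "(x, y) \<in> R ^^ k"
  shows "(y, x) \<in> R ^^ k"
  using assms(2)
proof (induction k arbitrary: y)
  case (Suc k)
  then obtain z where "(x, z) \<in> R ^^ k" "(z, y) \<in> R"
    by auto
  with Suc.IH show ?case
    using symD[OF assms(1)] by (blast intro: relpow_Suc_I2)
qed simp

text \<open>Going back and forth along the arc from \<open>y\<close> to \<open>z\<close> lengthens a
  walk by two without moving its end.\<close>

lemma relpow_sym_add_even:
  assumes "sym R" and "(x, y) \<in> R ^^ k" and "(y, z) \<in> R"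
  shows "(x, y) \<in> R ^^ (k + 2 * j)"
proof (induction j)
  case (Suc j)
  then have "(x, y) \<in> R ^^ Suc (Suc (k + 2 * j))"
    using assms(3) symD[OF assms(1,3)] by (blast intro: relpow_Suc_I)
  then show ?case by simp
qed (use assms in simp)

text \<open>Each step of a walk changes sides between \<open>A\<close> and its complement.\<close>

lemma two_coloured_relpow_parity:
  assumes "(x, y) \<in> R ^^ k" and "\<And>u v. (u, v) \<in> R \<Longrightarrow> u \<in> A \<longleftrightarrow> v \<notin> A"
  shows "(x \<in> A \<longleftrightarrow> y \<in> A) \<longleftrightarrow> even k"
  using assms(1)
proof (induction k arbitrary: y)
  case (Suc k)
  then obtain z where "(x, z) \<in> R ^^ k" "(z, y) \<in> R"
    by auto
  with Suc.IH[of z] assms(2)[of z y] show ?case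
    by auto
qed simp

context graph
begin

section \<open>Degrees, persistence of all-black, and bounds on \<open>two_way_MD\<close>\<close>

lemma finite_neighbours: "finite (neighbours G v)"
  by (rule finite_subset[of _ "verts G"]) (auto simp: neighbours_def adj_in_verts)

text \<open>Without parallel arcs, the arcs leaving \<open>v\<close> are told apart by their
  heads.\<close>

lemma card_neighbours: "card (neighbours G v) = out_degree G v"
proof -
  have "neighbours G v = head G ` out_arcs G v"
    by (auto simp: neighbours_def arcs_ends_conv)
  moreover have "inj_on (head G) (out_arcs G v)"
    by (rule inj_onI) (auto intro: no_multi_arcs simp: arc_to_ends_def)
  ultimately show ?thesis
    by (simp add: card_image out_degree_def)
qed

lemma min_degree_le_card_neighbours:
  "v \<in> verts G \<Longrightarrow> min_degree G \<le> card (neighbours G v)"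
  by (simp add: card_neighbours min_degree_def)

lemma all_black_step:
  assumes "r \<le> min_degree G" and "\<forall>v\<in>verts G. C v = Black" and "v \<in> verts G"
  shows "two_way_step G r C v = Black"
proof -
  have "{u \<in> neighbours G v. C u = Black} = neighbours G v"
    using assms(2) by (auto simp: neighbours_def adj_in_verts)
  then show ?thesis
    using min_degree_le_card_neighbours[OF assms(3)] assms(1) by (simp add: two_way_step_def)
qed

lemma all_black_config_mono:
  assumes "r \<le> min_degree G" and "\<forall>v\<in>verts G. two_way_config G r C t v = Black" and "t \<le> t'"
  shows "\<forall>v\<in>verts G. two_way_config G r C t' v = Black"
  using assms(3) by (induction rule: dec_induct) (use assms all_black_step in auto)

lemma two_way_dynamo_card_ge:
  assumes "verts G \<noteq> {}" and "1 \<le> r" and "r \<le> min_degree G" and "two_way_dynamo G r D"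
  shows "r \<le> card D"
proof (rule ccontr)
  assume less: "\<not> r \<le> card D"
  define C where "C v = (if v \<in> D then Black else White)" for v
  have finD: "finite D"
    using assms(4) finite_subset[OF _ finite_verts] by (simp add: two_way_dynamo_def)
  \<comment> \<open>Round 0 is left out, since the nodes of \<open>D\<close> are black there.
    Whiteness is claimed for every \<open>v\<close> of the type, so in the induction step the black
    count is 0, which is below \<open>r\<close>.\<close>
  have white: "two_way_config G r C (Suc t) v = White" for t v
  proof (induction t arbitrary: v)
    case 0
    have "card {u \<in> neighbours G v. C u = Black} \<le> card D"
      by (rule card_mono[OF finD]) (auto simp: C_def split: if_splits)
    with less show ?case
      by (simp add: two_way_step_def)
  next
    case (Suc t)
    have "two_way_config G r C (Suc (Suc t)) v
        = two_way_step G r (two_way_config G r C (Suc t)) v"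
      by simp
    also have "\<dots> = White"
      unfolding two_way_step_def Suc.IH using assms(2) by simp
    finally show ?case .
  qed
  obtain t where "\<forall>v\<in>verts G. two_way_config G r C t v = Black"
    using assms(4) unfolding two_way_dynamo_def by (metis C_def)
  \<comment> \<open>The round \<open>t\<close> could be 0, where \<open>white\<close> says nothing;
    persistence moves on to a round that it covers.\<close>
  then have "\<forall>v\<in>verts G. two_way_config G r C (Suc t) v = Black"
    using all_black_config_mono[OF assms(3), of C t "Suc t"] by simp
  with white assms(1) show False
    by auto
qed

lemma two_way_dynamo_verts: "two_way_dynamo G r (verts G)"
  unfolding two_way_dynamo_def by (metis order_refl two_way_config.simps(1))

lemma finite_two_way_dynamos: "finite {D. two_way_dynamo G r D}"
  by (rule finite_subset[of _ "Pow (verts G)"]) (auto simp: two_way_dynamo_def)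

lemma two_way_MD_le: "two_way_dynamo G r D \<Longrightarrow> two_way_MD G r \<le> card D"
  unfolding two_way_MD_def by (rule Min_le) (auto simp: finite_two_way_dynamos)

text \<open>\<open>Min\<close> needs a nonempty set here, and \<open>two_way_dynamo_verts\<close>
  provides a dynamo.\<close>

lemma two_way_MD_ge:
  assumes "\<And>D. two_way_dynamo G r D \<Longrightarrow> k \<le> card D"
  shows "k \<le> two_way_MD G r"
  unfolding two_way_MD_def
  by (rule Min.boundedI) (use assms two_way_dynamo_verts finite_two_way_dynamos in auto)

section \<open>Threshold 1: walks and parity\<close>

lemma two_way_step_1_iff:
  "two_way_step G 1 C v = Black \<longleftrightarrow> (\<exists>u. v \<rightarrow>\<^bsub>G\<^esub> u \<and> C u = Black)"
proof -
  have "1 \<le> card {u \<in> neighbours G v. C u = Black} \<longleftrightarrow> {u \<in> neighbours G v. C u = Black} \<noteq> {}"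
    using finite_neighbours by (simp add: Suc_le_eq card_gt_0_iff)
  then show ?thesis
    by (auto simp: two_way_step_def neighbours_def)
qed

text \<open>The last round looks at the neighbours of \<open>v\<close>, so the induction peels off
  the first arc of a walk starting at \<open>v\<close>.\<close>

lemma two_way_config_1_iff:
  "two_way_config G 1 C t v = Black \<longleftrightarrow> (\<exists>u. (v, u) \<in> arcs_ends G ^^ t \<and> C u = Black)"
proof (induction t arbitrary: v)
  case (Suc t)
  have "two_way_config G 1 C (Suc t) v = Black
      \<longleftrightarrow> (\<exists>w. v \<rightarrow>\<^bsub>G\<^esub> w \<and> (\<exists>u. (w, u) \<in> arcs_ends G ^^ t \<and> C u = Black))"
    unfolding two_way_config.simps two_way_step_1_iff Suc.IH ..
  then show ?case
    by (metis relpow_Suc_D2 relpow_Suc_I2)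
qed simp

text \<open>The sum of the individual bounds serves as a common round.\<close>

lemma two_way_dynamo_1I:
  assumes "D \<subseteq> verts G"
    and "\<And>v. v \<in> verts G \<Longrightarrow> \<exists>k. \<forall>t\<ge>k. \<exists>u\<in>D. (v, u) \<in> arcs_ends G ^^ t"
  shows "two_way_dynamo G 1 D"
proof -
  obtain k where k: "\<And>v t. v \<in> verts G \<Longrightarrow> k v \<le> t \<Longrightarrow> \<exists>u\<in>D. (v, u) \<in> arcs_ends G ^^ t"
    using assms(2) by metis
  have "\<exists>u\<in>D. (v, u) \<in> arcs_ends G ^^ sum k (verts G)" if "v \<in> verts G" for v
    using k[OF that] member_le_sum[OF that, of k] by simp
  then show ?thesis
    unfolding two_way_dynamo_def two_way_config_1_iff using assms(1) by meson
qed

lemma sym_arcs_ends: "sym (arcs_ends G)"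
  using sym_arcs by (simp add: symmetric_def)

text \<open>\<open>connected\<close> refers to the symmetric closure of the digraph; as arcs come in
  opposite pairs, it already yields directed walks.\<close>

lemma connected_walk:
  assumes "Digraph_Component.connected G" and "u \<in> verts G" and "v \<in> verts G"
  obtains k where "(u, v) \<in> arcs_ends G ^^ k"
proof -
  have "u \<rightarrow>\<^sup>*\<^bsub>G\<^esub> v"
    using symmetric_connected_imp_strongly_connected[OF sym_arcs assms(1)] assms(2,3) by auto
  then have "(u, v) \<in> (arcs_ends G)\<^sup>*"
    by (rule reachable_rtranclI)
  then show thesis
    using that by (auto simp: rtrancl_power)
qed

lemma arc_dynamo:
  assumes "Digraph_Component.connected G" and "u \<rightarrow>\<^bsub>G\<^esub> v"
  shows "two_way_dynamo G 1 {u, v}"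
proof (rule two_way_dynamo_1I)
  show "{u, v} \<subseteq> verts G"
    using assms(2) by (auto simp: adj_in_verts)
  have vu: "v \<rightarrow>\<^bsub>G\<^esub> u"
    using symD[OF sym_arcs_ends assms(2)] .
  fix x assume "x \<in> verts G"
  then obtain k where k: "(x, u) \<in> arcs_ends G ^^ k"
    using connected_walk[OF assms(1), of x u] assms(2) by (auto simp: adj_in_verts)
  \<comment> \<open>From length \<open>k\<close> on, each further step crosses from one end of the
    edge to the other.\<close>
  have "\<exists>w\<in>{u, v}. (x, w) \<in> arcs_ends G ^^ t" if "k \<le> t" for t
    using that
  proof (induction rule: dec_induct)
    case (step t)
    then show ?case
      using assms(2) vu by (auto intro: relpow_Suc_I)
  qed (use k in simp)
  then show "\<exists>k. \<forall>t\<ge>k. \<exists>w\<in>{u, v}. (x, w) \<in> arcs_ends G ^^ t"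
    by blast
qed

lemma bipartite_singleton_not_dynamo:
  assumes "bipartite G" and "u \<rightarrow>\<^bsub>G\<^esub> v"
  shows "\<not> two_way_dynamo G 1 {x}"
proof
  assume dyn: "two_way_dynamo G 1 {x}"
  obtain A B where AB: "A \<inter> B = {}"
      "\<forall>a b. a \<rightarrow>\<^bsub>G\<^esub> b \<longrightarrow> (a \<in> A \<and> b \<in> B) \<or> (a \<in> B \<and> b \<in> A)"
    using assms(1) unfolding bipartite_def by metis
  have A: "a \<in> A \<longleftrightarrow> b \<notin> A" if "a \<rightarrow>\<^bsub>G\<^esub> b" for a b
    using AB(1) AB(2)[rule_format, OF that] by blast
  define C where "C y = (if y = x then Black else White)" for y
  have C: "C y = Black \<longleftrightarrow> y = x" for y
    by (simp add: C_def)
  obtain t where t: "\<forall>y\<in>verts G. two_way_config G 1 C t y = Black"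
    using dyn unfolding two_way_dynamo_def by (metis C singletonD)
  have "(y, x) \<in> arcs_ends G ^^ t" if "y \<in> verts G" for y
    using t that unfolding two_way_config_1_iff C by auto
  then have "(u, x) \<in> arcs_ends G ^^ t" "(v, x) \<in> arcs_ends G ^^ t"
    using assms(2) by (auto simp: adj_in_verts)
  \<comment> \<open>Both walks have length \<open>t\<close>, so the parity of \<open>t\<close>
    decides for \<open>u\<close> and \<open>v\<close> alike whether they lie on the side of
    \<open>x\<close>.\<close>
  then have "u \<in> A \<longleftrightarrow> v \<in> A"
    using two_coloured_relpow_parity[OF _ A] by blast
  with A assms(2) show False
    by blast
qed

text \<open>The two sides are the nodes reached from \<open>x\<close> by walks of even and of odd
  length. A node on both sides would close up an odd walk at \<open>x\<close>: out along one walk,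
  back along the reverse of the other.\<close>

lemma bipartiteI_no_odd_closed_walk:
  assumes "Digraph_Component.connected G" and "x \<in> verts G"
    and no_odd: "\<And>k. (x, x) \<in> arcs_ends G ^^ k \<Longrightarrow> even k"
  shows "bipartite G"
proof -
  define S where "S p = {y \<in> verts G. \<exists>k. even k = p \<and> (x, y) \<in> arcs_ends G ^^ k}" for p
  have cover: "S True \<union> S False = verts G"
  proof (intro subset_antisym subsetI)
    fix y assume y: "y \<in> verts G"
    then obtain k where "(x, y) \<in> arcs_ends G ^^ k"
      using connected_walk[OF assms(1,2)] by metis
    with y show "y \<in> S True \<union> S False"
      by (cases "even k") (auto simp: S_def)
  qed (auto simp: S_def)
  have disjoint: "S True \<inter> S False = {}"
  proof -
    have False if "(x, y) \<in> arcs_ends G ^^ k" "(x, y) \<in> arcs_ends G ^^ l" "even k" "odd l" for y k l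
    proof -
      have "(x, x) \<in> arcs_ends G ^^ (k + l)"
        unfolding relpow_add using that(1) relpow_sym[OF sym_arcs_ends that(2)] by blast
      then show False
        using no_odd that(3,4) by fastforce
    qed
    then show ?thesis
      unfolding S_def by auto
  qed
  have flip: "v \<in> S (\<not> p)" if "u \<rightarrow>\<^bsub>G\<^esub> v" "u \<in> S p" for u v p
  proof -
    obtain k where "even k = p" "(x, u) \<in> arcs_ends G ^^ k"
      using \<open>u \<in> S p\<close> by (auto simp: S_def)
    then have "even (Suc k) = (\<not> p)" "(x, v) \<in> arcs_ends G ^^ Suc k"
      using that(1) by (auto intro: relpow_Suc_I)
    then show ?thesis
      using adj_in_verts(2)[OF that(1)] unfolding S_def by blast
  qed
  have "(u \<in> S True \<and> v \<in> S False) \<or> (u \<in> S False \<and> v \<in> S True)"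
    if "u \<rightarrow>\<^bsub>G\<^esub> v" for u v
    using flip[OF that, of True] flip[OF that, of False] adj_in_verts(1)[OF that] cover by auto
  with cover disjoint show ?thesis
    unfolding bipartite_def by (intro exI conjI allI impI)
qed

lemma not_bipartite_singleton_dynamo:
  assumes "Digraph_Component.connected G" and "\<not> bipartite G" and "x \<rightarrow>\<^bsub>G\<^esub> z"
  shows "two_way_dynamo G 1 {x}"
proof (rule two_way_dynamo_1I)
  show x: "{x} \<subseteq> verts G"
    using assms(3) by (auto simp: adj_in_verts)
  obtain m where m: "(x, x) \<in> arcs_ends G ^^ m" "odd m"
    using bipartiteI_no_odd_closed_walk[OF assms(1)] assms(2) x by auto
  fix y assume "y \<in> verts G"
  then obtain k where k: "(y, x) \<in> arcs_ends G ^^ k"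
    using connected_walk[OF assms(1), of y x] x by auto
  then have km: "(y, x) \<in> arcs_ends G ^^ (k + m)"
    unfolding relpow_add using m(1) by blast
  \<comment> \<open>If \<open>t\<close> has the parity of \<open>k\<close>, the direct walk is
    padded at \<open>x\<close> along the arc to \<open>z\<close>; otherwise the walk with the odd
    detour of length \<open>m\<close> is padded.\<close>
  have "(y, x) \<in> arcs_ends G ^^ t" if "k + m \<le> t" for t
  proof (cases "even (t - k)")
    case True
    then obtain j where "t = k + 2 * j"
      using \<open>k + m \<le> t\<close> by (metis add_leD1 evenE le_add_diff_inverse)
    then show ?thesis
      using relpow_sym_add_even[OF sym_arcs_ends k assms(3)] by simp
  next
    case False
    then have "even (t - (k + m))"
      using \<open>k + m \<le> t\<close> m(2) by auto
    then obtain j where "t = k + m + 2 * j"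
      using \<open>k + m \<le> t\<close> by (metis evenE le_add_diff_inverse)
    then show ?thesis
      using relpow_sym_add_even[OF sym_arcs_ends km assms(3)] by simp
  qed
  then show "\<exists>k. \<forall>t\<ge>k. \<exists>u\<in>{x}. (y, u) \<in> arcs_ends G ^^ t"
    by blast
qed

end

theorem theorem4:
  fixes G :: "('a, 'b) pre_digraph" and n r :: nat
  assumes "graph G"
    and "Digraph_Component.connected G"
    and "n = card (verts G)"
    and "1 \<le> r"
    and "r \<le> min_degree G"
  shows "(2 \<le> r \<longrightarrow> r \<le> two_way_MD G r \<and> two_way_MD G r \<le> n) \<and>
    (r = 1 \<and> 2 \<le> n \<longrightarrow> two_way_MD G r = (if bipartite G then 2 else 1))"
proof -
  interpret graph G by fact
  \<comment> \<open>Strong connectivity includes the existence of a node.\<close>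
  have ne: "verts G \<noteq> {}"
    using symmetric_connected_imp_strongly_connected[OF sym_arcs assms(2)]
    by (simp add: strongly_connected_def)
  have ge: "r \<le> two_way_MD G r"
    by (rule two_way_MD_ge) (rule two_way_dynamo_card_ge[OF ne assms(4,5)])
  have le: "two_way_MD G r \<le> n"
    using two_way_MD_le[OF two_way_dynamo_verts] assms(3) by simp
  have "two_way_MD G 1 = (if bipartite G then 2 else 1)" if "r = 1"
  proof -
    obtain u where u: "u \<in> verts G"
      using ne by blast
    \<comment> \<open>The degree of \<open>u\<close> is at least \<open>r\<close>, hence positive;
      this supplies the edge that both cases rest on.\<close>
    then have "neighbours G u \<noteq> {}"
      using min_degree_le_card_neighbours[OF u] assms(4,5) by auto
    then obtain v where uv: "u \<rightarrow>\<^bsub>G\<^esub> v"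
      by (auto simp: neighbours_def)
    show ?thesis
    proof (cases "bipartite G")
      case True
      have "2 \<le> card D" if "two_way_dynamo G 1 D" for D
      proof -
        have "1 \<le> card D"
          using two_way_dynamo_card_ge[OF ne _ _ that] assms(4,5) by simp
        moreover have "card D \<noteq> 1"
          using bipartite_singleton_not_dynamo[OF True uv] that by (metis card_1_singletonE)
        ultimately show ?thesis by simp
      qed
      then have "2 \<le> two_way_MD G 1"
        by (rule two_way_MD_ge)
      moreover have "two_way_MD G 1 \<le> 2"
        using two_way_MD_le[OF arc_dynamo[OF assms(2) uv]] card_insert_le_m1[of 2 "{v}" u] by simp
      ultimately show ?thesis
        using True by simp
    next
      case False
      then show ?thesis
        using two_way_MD_le[OF not_bipartite_singleton_dynamo[OF assms(2) False uv]] ge \<open>r = 1\<close>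
        by simp
    qed
  qed
  with ge le show ?thesis
    by blast
qed

end
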